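(* Let $d$ be a non-negative real number and $n$ a positive integer. If $G$ is a balanced bipartite graph with partite sets $A$ and $B$, $|A|=|B|=n$ (so $G$ has order $2n$), and $G$ has at most $dn$ edges, then $\tilde{\alpha}(G)\geq \frac{n}{d+1}-2$.
   Context: All graphs are finite, simple and undirected. A bipartite graph $G$ is always considered with a fixed bipartition into partite sets $A$ and $B$; it is balanced if $|A|=|B|$. A bihole of order $k$ in $G$ is an independent set $I$ of $G$ with $|I\cap A|=|I\cap B|=k$. $\tilde{\alpha}(G)$ denotes the largest order of a bihole in $G$. *)

theory Defs
  imports Complex_Main "HOL-Library.Ramsey"
begin

text \<open>
  A finite simple undirected graph is given by its vertex set \<open>V\<close> and its set \<open>E\<close> of edges,
  which are two-element subsets of \<open>V\<close>.  Independence of a vertex set is the predicate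
  \<^const>\<open>indep\<close> of \<^theory>\<open>HOL-Library.Ramsey\<close>.
\<close>

definition simple_graph :: "'a set \<Rightarrow> 'a set set \<Rightarrow> bool" where
  "simple_graph V E \<longleftrightarrow> finite V \<and> E \<subseteq> nsets V 2"

definition bipartite_graph :: "'a set \<Rightarrow> 'a set \<Rightarrow> 'a set set \<Rightarrow> bool" where
  "bipartite_graph A B E \<longleftrightarrow>
     simple_graph (A \<union> B) E \<and> A \<inter> B = {} \<and> indep A E \<and> indep B E"

definition balanced :: "'a set \<Rightarrow> 'a set \<Rightarrow> bool" where
  "balanced A B \<longleftrightarrow> card A = card B"

definition bihole :: "'a set \<Rightarrow> 'a set \<Rightarrow> 'a set set \<Rightarrow> nat \<Rightarrow> 'a set \<Rightarrow> bool" where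
  "bihole A B E k I \<longleftrightarrow>
     I \<subseteq> A \<union> B \<and> indep I E \<and> card (I \<inter> A) = k \<and> card (I \<inter> B) = k"

definition bihole_number :: "'a set \<Rightarrow> 'a set \<Rightarrow> 'a set set \<Rightarrow> nat" where
  "bihole_number A B E = Max {k. \<exists>I. bihole A B E k I}"

text \<open>For a finite graph the maximum ranges over a finite nonempty set.\<close>

lemma finite_bihole_orders:
  assumes "bipartite_graph A B E"
  shows "finite {k. \<exists>I. bihole A B E k I}"
proof (rule finite_subset)
  have "finite A"
    using assms by (simp add: bipartite_graph_def simple_graph_def)
  then show "{k. \<exists>I. bihole A B E k I} \<subseteq> {..card A}"
    by (auto simp: bihole_def intro: card_mono)
qed simp

lemma bihole_zero: "bihole A B E 0 {}"
  by (simp add: bihole_def)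

end

theory Submission
  imports Defs
begin

text \<open>
  For \<open>m\<close> edges between parts of size \<open>n\<close> and an integer \<open>k \<ge> 1\<close>, put
  \<open>F\<^sub>k = (2 k n - m) / (k (k + 1))\<close>; for \<open>(k - 1) n \<le> m \<le> k n\<close> this is the chord of the
  convex function \<open>n / (m / n + 1)\<close>, hence dominates it.  Delete greedily one vertex of large degree
  from each part.  Deleting a pair that covers \<open>2 k\<close> edges leaves \<open>F\<^sub>k\<close> unchanged, and
  such a pair exists as soon as \<open>m > (k - 1) n + k\<close>.  In the remaining range
  \<open>(k - 1) n < m \<le> (k - 1) n + k\<close> some pair covers \<open>2 k - 1\<close> edges, which costs
  \<open>1 / (k (k + 1))\<close> but brings the graph down to level \<open>k - 1\<close>.  So each level is charged
  at most once, and the total loss is below \<open>\<Sum> 1 / (k (k + 1)) = 1\<close>.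
\<close>

section \<open>Degrees in a bipartite relation\<close>

lemma ex_card_Image_gt:
  assumes "finite A" "finite B" "R \<subseteq> A \<times> B" "c * card A < card R"
  shows "\<exists>a\<in>A. c < card (R `` {a})"
proof (rule ccontr)
  assume neg: "\<not> ?thesis"
  have "R = (SIGMA a:A. R `` {a})"
    using assms(3) by auto
  moreover have fin: "\<forall>a\<in>A. finite (R `` {a})"
    using assms(2,3) by (auto intro: finite_subset[of _ B])
  ultimately have "card R = (\<Sum>a\<in>A. card (R `` {a}))"
    using card_SigmaI[OF assms(1) fin] by simp
  also have "\<dots> \<le> c * card A"
    using neg sum_bounded_above[of A "\<lambda>a. card (R `` {a})" c] by (auto simp: mult.commute not_less)
  finally show False
    using assms(4) by simp
qed

lemma card_Diff_row:
  assumes "finite R"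
  shows "card (R - {a} \<times> UNIV) + card (R `` {a}) = card R"
proof -
  have "card (R `` {a}) = card (Pair a ` (R `` {a}))"
    by (simp add: card_image inj_on_def)
  also have "Pair a ` (R `` {a}) = R \<inter> {a} \<times> UNIV"
    by auto
  finally show ?thesis
    using card_Diff_subset_Int[of R "{a} \<times> UNIV"] card_mono[of R "R \<inter> {a} \<times> UNIV"] assms
    by simp
qed

lemma card_Diff_column:
  assumes "finite R"
  shows "card (R - UNIV \<times> {b}) + card (R\<inverse> `` {b}) = card R"
proof -
  have "R\<inverse> - {b} \<times> UNIV = (R - UNIV \<times> {b})\<inverse>"
    by auto
  then show ?thesis
    using card_Diff_row[of "R\<inverse>" b] assms by simp
qed

text \<open>Averaging gives \<open>a\<close> of degree \<open>j + 1 + e\<close>. A surplus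
  \<open>e\<close> removes \<open>e\<close> further edges but lowers the degree required of
  \<open>b\<close> by \<open>e\<close>, that is, the edge count needed for a second averaging by a
  multiple of \<open>n\<close>.\<close>

lemma ex_pair_covering_many:
  fixes R :: "('a \<times> 'b) set"
  assumes fin: "finite A" "finite B" and card: "card A = n" "card B = n"
    and R: "R \<subseteq> A \<times> B" and gt: "j * n < card R"
  obtains a b where "a \<in> A" "b \<in> B"
    "card (R \<inter> (A - {a}) \<times> (B - {b})) + (2 * j + 1) \<le> card R"
    "j * n + j + 1 < card R \<Longrightarrow> card (R \<inter> (A - {a}) \<times> (B - {b})) + (2 * j + 2) \<le> card R"
proof -
  have finR: "finite R"
    using R fin finite_subset by blast
  obtain a where a: "a \<in> A" "j < card (R `` {a})"
    using ex_card_Image_gt[OF fin R] gt card by auto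
  obtain e where e: "card (R `` {a}) = j + 1 + e"
    using a(2) less_imp_Suc_add by fastforce
  have n: "j + 1 + e \<le> n"
    using card_mono[OF fin(2), of "R `` {a}"] R e card by auto
  define R1 where "R1 = R - {a} \<times> UNIV"
  have R1: "card R1 + (j + 1 + e) = card R" "finite R1" "R1\<inverse> \<subseteq> B \<times> A"
    using card_Diff_row[OF finR, of a] e finR R by (auto simp: R1_def)
  have ex_b: "\<exists>b\<in>B. s \<le> card (R1\<inverse> `` {b})" if "s = 0 \<or> (s - 1) * n < card R1" for s
  proof (cases s)
    case 0
    have "B \<noteq> {}"
      using n card by auto
    with 0 show ?thesis by auto
  next
    case (Suc i)
    then show ?thesis
      using ex_card_Image_gt[OF fin(2,1) R1(3), of i] that card by (auto simp: Suc_le_eq)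
  qed
  \<comment> \<open>The degree that \<open>b\<close> must contribute after the row of
    \<open>a\<close> is gone. Truncated subtraction gives 0 when \<open>a\<close> alone covers
    enough, and then any \<open>b\<close> will do.\<close>
  define s where "s = (if j * n + j + 1 < card R then j + 1 - e else j - e)"
  have "s = 0 \<or> (s - 1) * n < card R1"
  proof (cases "s = 0")
    case False
    show ?thesis
    proof (cases "j * n + j + 1 < card R")
      case True
      with False have "e \<le> j" "s - 1 = j - e"
        by (auto simp: s_def)
      then obtain i where i: "j = e + i" "s - 1 = i"
        using le_Suc_ex by fastforce
      have "e \<le> e * n"
        using n by simp
      moreover have "j * n = e * n + i * n"
        by (simp add: i add_mult_distrib)
      ultimately have "i * n < card R1"
        using True R1(1) by linarith
      then show ?thesis using i by simp
    next
      case small: False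
      with False have "e < j" "s - 1 = j - e - 1"
        by (auto simp: s_def)
      then obtain i where i: "j = e + 1 + i" "s - 1 = i"
        using less_imp_Suc_add by fastforce
      have "e * n + n \<ge> j + 1 + e"
        using n by linarith
      moreover have "j * n = e * n + n + i * n"
        by (simp add: i add_mult_distrib)
      ultimately have "i * n < card R1"
        using gt R1(1) by linarith
      then show ?thesis using i by simp
    qed
  qed simp
  then obtain b where b: "b \<in> B" "s \<le> card (R1\<inverse> `` {b})"
    using ex_b by blast
  have eq: "R \<inter> (A - {a}) \<times> (B - {b}) = R1 - UNIV \<times> {b}"
    using R by (auto simp: R1_def)
  have "card (R1 - UNIV \<times> {b}) + card (R1\<inverse> `` {b}) = card R1"
    by (rule card_Diff_column[OF R1(2)])
  with b R1(1) have "card (R \<inter> (A - {a}) \<times> (B - {b})) + s + (j + 1 + e) \<le> card R"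
    unfolding eq by linarith
  then show thesis
    by (intro that[OF a(1) b(1)]) (auto simp: s_def split: if_splits)
qed

text \<open>
  This is \<open>F\<^sub>k\<close> minus the loss \<open>\<Sum>i=1..k. 1 / (i (i + 1)) = k / (k + 1)\<close> of the levels
  up to \<open>k\<close>.
\<close>

definition square_bound :: "nat \<Rightarrow> nat \<Rightarrow> nat \<Rightarrow> real" where
  "square_bound k n m = (2 * real k * real n - real m - real k ^ 2) / (real k * (real k + 1))"

text \<open>Over the common denominator \<open>j * (j + 1) * (j + 2)\<close> the two sides differ by
  exactly \<open>2 * (j * n - m)\<close>.\<close>

lemma square_bound_Suc_le:
  assumes "j > 0" "m \<le> j * n"
  shows "square_bound (Suc j) n m + 1 / (real (Suc j) * (real (Suc j) + 1)) \<le> square_bound j n m"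
proof -
  have "real m \<le> real j * real n"
    using assms(2) by (metis of_nat_le_iff of_nat_mult)
  then have "real j * (2 * (real j + 1) * real n - real m - (real j + 1) ^ 2 + 1)
      \<le> (real j + 2) * (2 * real j * real n - real m - real j ^ 2)" (is "real j * ?P \<le> _ * ?Q")
    by (simp add: algebra_simps power2_eq_square)
  then have "real j * ?P / (real j * (real j + 1) * (real j + 2))
      \<le> (real j + 2) * ?Q / (real j * (real j + 1) * (real j + 2))"
    by (intro divide_right_mono) auto
  moreover have "real j * ?P / (real j * (real j + 1) * (real j + 2))
      = ?P / ((real j + 1) * (real j + 2))"
    using assms(1) by (simp add: mult.assoc)
  moreover have "(real j + 2) * ?Q / (real j * (real j + 1) * (real j + 2))
      = ?Q / (real j * (real j + 1))"
    by simp
  moreover have "real (Suc j) = real j + 1" "real (Suc j) + 1 = real j + 2"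
    by simp_all
  ultimately show ?thesis
    unfolding square_bound_def by (simp only: add_divide_distrib[symmetric])
qed

text \<open>In the numerator, 2k deleted edges make up for one vertex less on each side;
  \<open>c\<close> is the shortfall.\<close>

lemma square_bound_le_step:
  assumes "k > 0" "m' + 2 * k \<le> m + c"
  shows "square_bound k (Suc n) m \<le> square_bound k n m' + real c / (real k * (real k + 1))"
proof -
  have "real m' + 2 * real k \<le> real m + real c"
    using assms(2) by linarith
  then show ?thesis
    unfolding square_bound_def add_divide_distrib[symmetric]
    by (intro divide_right_mono) (auto simp: algebra_simps)
qed

lemma square_bound_le:
  assumes "k > 0"
  shows "square_bound k n m \<le> real n"
proof -
  have "2 * k * n \<le> (k * (k + 1)) * n"
    using assms by (intro mult_right_mono) auto
  then have "2 * real k * real n \<le> real k * (real k + 1) * real n"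
    by (metis (mono_tags, lifting) of_nat_1 of_nat_add of_nat_le_iff of_nat_mult of_nat_numeral)
  then have "2 * real k * real n - real m - real k ^ 2 \<le> real n * (real k * (real k + 1))"
    using zero_le_power2[of "real k"] by (simp only: mult.commute[of "real n"])
  then show ?thesis
    using assms by (simp add: square_bound_def pos_divide_le_eq)
qed

section \<open>Greedy deletion\<close>

lemma ex_empty_square:
  fixes R :: "('a \<times> 'b) set" and k :: nat
  assumes "finite A" "finite B" "card A = n" "card B = n"
    and "R \<subseteq> A \<times> B" "k > 0" "card R \<le> k * n"
  shows "\<exists>X Y. X \<subseteq> A \<and> Y \<subseteq> B \<and> card X = card Y \<and> R \<inter> X \<times> Y = {} \<and>
    square_bound k n (card R) \<le> real (card X)"
  \<comment> \<open>Each recursive call lowers \<open>n\<close> (a pair is deleted),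
    \<open>k\<close> (a level is left), or both.\<close>
  using assms
proof (induction "n + k" arbitrary: n k A B R rule: less_induct)
  case less
  note fin = less.prems(1,2) and cards = less.prems(3,4) and R = less.prems(5)
  have finR: "finite R"
    using R fin finite_subset by blast
  obtain j where j: "k = Suc j"
    using less.prems(6) gr0_implies_Suc by blast
  consider "R = {}" | "R \<noteq> {}" "card R \<le> j * n" | "j * n < card R"
    by linarith
  then show ?case
  proof cases
    case 1
    then show ?thesis
      using square_bound_le[OF less.prems(6)] cards by (intro exI[of _ A] exI[of _ B]) auto
  next
    case 2
    then have "j > 0"
      using finR by (cases j) auto
    then have "square_bound k n (card R) \<le> square_bound j n (card R)"
      using square_bound_Suc_le[OF _ 2(2)] unfolding j
      by (smt (verit, best) divide_nonneg_nonneg mult_nonneg_nonneg of_nat_0_le_iff)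
    moreover have "\<exists>X Y. X \<subseteq> A \<and> Y \<subseteq> B \<and> card X = card Y \<and> R \<inter> X \<times> Y = {} \<and>
        square_bound j n (card R) \<le> real (card X)"
      using j \<open>j > 0\<close> 2(2) by (intro less.hyps[OF _ fin cards R]) auto
    ultimately show ?thesis
      using order_trans by blast
  next
    case 3
    then obtain a b where ab: "a \<in> A" "b \<in> B"
      and le: "card (R \<inter> (A - {a}) \<times> (B - {b})) + (2 * j + 1) \<le> card R"
        "j * n + j + 1 < card R \<Longrightarrow> card (R \<inter> (A - {a}) \<times> (B - {b})) + (2 * j + 2) \<le> card R"
      using ex_pair_covering_many[OF fin cards R] by metis
    define A' B' R' where "A' = A - {a}" and "B' = B - {b}" and "R' = R \<inter> A' \<times> B'"
    note le = le[folded A'_def B'_def, folded R'_def]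
    obtain n' where n': "n = Suc n'"
      using ab(1) fin(1) cards(1) by (metis card_gt_0_iff empty_iff gr0_implies_Suc)
    have prems': "finite A'" "finite B'" "card A' = n'" "card B' = n'" "R' \<subseteq> A' \<times> B'"
      using fin cards ab n' by (auto simp: A'_def B'_def R'_def)
    \<comment> \<open>Shared by both kinds of deletion: \<open>i = k\<close> stays on the level,
      \<open>i = j\<close> leaves it. Sets avoiding \<open>a\<close> and \<open>b\<close> see the
      same edges in \<open>R'\<close> as in \<open>R\<close>.\<close>
    have step: ?thesis if i: "i > 0" "i \<le> k" "card R' \<le> i * n'"
      "square_bound k n (card R) \<le> square_bound i n' (card R')" for i
    proof -
      have "n' + i < n + k"
        using i(2) n' by simp
      then obtain X Y where XY: "X \<subseteq> A'" "Y \<subseteq> B'" "card X = card Y" "R' \<inter> X \<times> Y = {}"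
        "square_bound i n' (card R') \<le> real (card X)"
        using less.hyps[OF _ prems' i(1,3)] by metis
      have "R \<inter> X \<times> Y = {}"
        using XY(1,2,4) by (auto simp: R'_def)
      moreover have "X \<subseteq> A" "Y \<subseteq> B"
        using XY(1,2) by (auto simp: A'_def B'_def)
      moreover have "square_bound k n (card R) \<le> real (card X)"
        using XY(5) i(4) by linarith
      ultimately show ?thesis
        using XY(3) by metis
    qed
    show ?thesis
    proof (cases "j * n + j + 1 < card R")
      case True
      have "card R' \<le> k * n'"
        using le(2)[OF True] less.prems(7) by (simp add: j n')
      moreover have "square_bound k n (card R) \<le> square_bound k n' (card R')"
        using square_bound_le_step[of k "card R'" "card R" 0 n'] le(2)[OF True] by (simp add: j n')
      ultimately show ?thesis
        using step[of k] less.prems(6) by blast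
    next
      case False
      \<comment> \<open>Here \<open>card R \<le> j * n' + 2 * j + 1\<close>, and the pair covers at
        least \<open>2 * j + 1\<close> edges.\<close>
      then have R'_le: "card R' \<le> j * n'"
        using le(1) by (simp add: n')
      show ?thesis
      \<comment> \<open>There is no level 0 to descend to, but then no edge is left and
        \<open>A'\<close>, \<open>B'\<close> themselves serve; the bound is at most
        \<open>n'\<close> because \<open>R\<close> had an edge.\<close>
      proof (cases "j = 0")
        case True
        have "R' = {}"
          using R'_le True finR by (simp add: R'_def)
        moreover have "square_bound k n (card R) \<le> real n'"
          using 3 by (simp add: square_bound_def j True n')
        ultimately show ?thesis
          using prems' by (intro exI[of _ A'] exI[of _ B']) (auto simp: A'_def B'_def R'_def)
      next
        case False
        have "square_bound k n (card R) \<le> square_bound k n' (card R') + 1 / (real k * (real k + 1))"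
          using square_bound_le_step[of k "card R'" "card R" 1 n'] le(1) by (simp add: j n')
        also have "\<dots> \<le> square_bound j n' (card R')"
          using square_bound_Suc_le[OF _ R'_le] False by (simp add: j)
        finally show ?thesis
          using step[of j] False R'_le j by auto
      qed
    qed
  qed
qed

section \<open>From empty squares to biholes\<close>

theorem theorem2:
  fixes d :: real and n :: nat
    and A B :: "'a set" and E :: "'a set set"
  assumes "d \<ge> 0" and "n > 0"
    and "bipartite_graph A B E" and "balanced A B"
    and "card A = n" and "card B = n"
    and "real (card E) \<le> d * real n"
  shows "real (bihole_number A B E) \<ge> real n / (d + 1) - 2"
proof -
  have fin: "finite A" "finite B" and E: "E \<subseteq> nsets (A \<union> B) 2"
    and disj: "A \<inter> B = {}" and indep: "indep A E" "indep B E"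
    using assms(3) by (auto simp: bipartite_graph_def simple_graph_def)
  define R where "R = {(x, y) \<in> A \<times> B. {x, y} \<in> E}"
  have "inj_on (\<lambda>(x, y). {x, y}) R"
    using disj by (auto simp: R_def inj_on_def doubleton_eq_iff)
  moreover have "(\<lambda>(x, y). {x, y}) ` R \<subseteq> E"
    by (auto simp: R_def)
  moreover have "finite E"
    using E fin finite_imp_finite_nsets[of "A \<union> B" 2] finite_subset by blast
  ultimately have card_R: "real (card R) \<le> d * real n"
    using card_inj_on_le assms(7) by (metis of_nat_le_iff order_trans)
  \<comment> \<open>The level with \<open>k - 1 \<le> d \<le> k\<close>; the successor keeps it
    positive when \<open>d < 1\<close>.\<close>
  define k where "k = Suc (nat \<lfloor>d\<rfloor>)"
  have k: "k > 0" "d \<le> real k" "real k \<le> d + 1"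
    using assms(1) by (auto simp: k_def) linarith+
  have "real (card R) \<le> real k * real n"
    using card_R k(2) by (meson mult_right_mono of_nat_0_le_iff order_trans)
  then have "card R \<le> k * n"
    by (metis of_nat_le_iff of_nat_mult)
  moreover have "R \<subseteq> A \<times> B"
    by (auto simp: R_def)
  ultimately obtain X Y where XY: "X \<subseteq> A" "Y \<subseteq> B" "card X = card Y" "R \<inter> X \<times> Y = {}"
    "square_bound k n (card R) \<le> real (card X)"
    using ex_empty_square[OF fin assms(5,6) _ k(1)] by metis
  have "bihole A B E (card X) (X \<union> Y)"
  proof -
    have "(X \<union> Y) \<inter> A = X" "(X \<union> Y) \<inter> B = Y"
      using XY(1,2) disj by auto
    moreover have "{x, y} \<notin> E" if "x \<in> X" "y \<in> Y" for x y
      using that XY(1,2,4) by (auto simp: R_def)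
    then have "indep (X \<union> Y) E"
      using smaller_indep[OF indep(1) XY(1)] smaller_indep[OF indep(2) XY(2)]
      unfolding indep_def by (metis Un_iff insert_commute)
    ultimately show ?thesis
      using XY(1-3) by (auto simp: bihole_def)
  qed
  then have "card X \<le> bihole_number A B E"
    unfolding bihole_number_def by (intro Max_ge finite_bihole_orders[OF assms(3)]) auto
  moreover have "real n / (d + 1) - 1 \<le> square_bound k n (card R)"
  proof -
    \<comment> \<open>Convexity: on \<open>[k - 1, k]\<close> the function
      \<open>1 / (x + 1)\<close> lies below its chord \<open>(2 * k - x) / (k * (k + 1))\<close>. At
      \<open>x = d\<close> the gap, with denominators cleared, is this product.\<close>
    have "0 \<le> (real k - d) * (1 - (real k - d))"
      using k by simp
    then have "real k * (real k + 1) \<le> (2 * real k - d) * (d + 1)"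
      by (simp add: algebra_simps)
    then have "real n * (real k * (real k + 1)) \<le> real n * ((2 * real k - d) * (d + 1))"
      by (intro mult_left_mono) auto
    moreover have "0 < real k * (real k + 1)" "0 < d + 1"
      using k(1) assms(1) by auto
    ultimately have "real n / (d + 1) \<le> real n * (2 * real k - d) / (real k * (real k + 1))"
      by (simp only: pos_divide_le_eq pos_le_divide_eq times_divide_eq_left mult.assoc)
    also have "\<dots> \<le> (2 * real k * real n - real (card R)) / (real k * (real k + 1))"
      using card_R by (intro divide_right_mono) (auto simp: algebra_simps)
    also have "\<dots> \<le> square_bound k n (card R) + 1"
    proof -
      have "real k ^ 2 / (real k * (real k + 1)) \<le> 1"
        using k(1) by (simp add: power2_eq_square)
      then show ?thesis
        unfolding square_bound_def diff_divide_distrib by linarith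
    qed
    finally show ?thesis by simp
  qed
  ultimately show ?thesis
    using XY(5) by linarith
qed

end
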